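(* Let $\lambda$ be a nonzero real number, $\gamma$ a complex number, and $Y$ a random variable as in the context. For every integer $n\ge0$ with $\gamma\neq n$, \[ C_{n,\lambda}^{(\gamma,Y)}=\frac{\gamma}{\gamma-n}\beta_{n,\lambda}^{(n-\gamma,Y)}. \]
   Context: $(x)_{0,\lambda}=1$, $(x)_{n,\lambda}=x(x-\lambda)\cdots(x-(n-1)\lambda)$ for $n\ge1$. $Y$ is a random variable whose moment-generating function $E[e^{tY}]$ exists for $|t|<r$ for some $r>0$, and $E[Y]\neq0$. $E[e_{\lambda}^{Y}(t)]$ denotes the formal power series $\sum_{n\ge0}E[(Y)_{n,\lambda}]\frac{t^n}{n!}$; the probabilistic degenerate logarithm $\log_{\lambda}^{Y}(1+t)$ is the compositional inverse of the delta series $E[e_{\lambda}^{Y}(t)]-1$. The probabilistic degenerate Bernoulli numbers of order $\gamma$: $\big(\frac{t}{E[e_{\lambda}^{Y}(t)]-1}\big)^{\gamma}=\sum_{n\ge0}\beta_{n,\lambda}^{(\gamma,Y)}\frac{t^n}{n!}$. The probabilistic degenerate Cauchy numbers of order $\gamma$: $\big(\frac{t}{\log_{\lambda}^{Y}(1+t)}\big)^{\gamma}=\sum_{n\ge0}C_{n,\lambda}^{(\gamma,Y)}\frac{t^n}{n!}$. Complex powers of series with constant term $c=E[Y]^{\pm1}$ are taken as $c^{\gamma}(1+u)^{\gamma}=c^\gamma\sum_m\binom{\gamma}{m}u^m$ ($u(0)=0$), using one fixed determination $E[Y]^{s}$ ($s\in\mathbb C$) with $E[Y]^{s+s'}=E[Y]^sE[Y]^{s'}$,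 and $(1/E[Y])^{s}:=E[Y]^{-s}$. *)

theory Defs
  imports "HOL-Probability.Probability" "HOL-Computational_Algebra.Computational_Algebra"
begin

definition deg_ffact :: "real \<Rightarrow> real \<Rightarrow> nat \<Rightarrow> real" where
  "deg_ffact lam x n = (\<Prod>i<n. x - real i * lam)"

definition has_mgf_near_0 :: "'a measure \<Rightarrow> ('a \<Rightarrow> real) \<Rightarrow> bool" where
  "has_mgf_near_0 M Y \<longleftrightarrow>
     (\<exists>r>0. \<forall>t::real. \<bar>t\<bar> < r \<longrightarrow> integrable M (\<lambda>\<omega>. exp (t * Y \<omega>)))"

text \<open>Series have complex coefficients because their powers are complex.\<close>

definition prob_deg_exp :: "'a measure \<Rightarrow> ('a \<Rightarrow> real) \<Rightarrow> real \<Rightarrow> complex fps" where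
  "prob_deg_exp M Y lam =
     Abs_fps (\<lambda>n. complex_of_real (integral\<^sup>L M (\<lambda>\<omega>. deg_ffact lam (Y \<omega>) n)) / fact n)"

text \<open>The series \<open>log(1 + t)\<close> in \<open>t\<close>; \<^const>\<open>fps_inv\<close> is the compositional inverse.\<close>

definition prob_deg_log1p :: "'a measure \<Rightarrow> ('a \<Rightarrow> real) \<Rightarrow> real \<Rightarrow> complex fps" where
  "prob_deg_log1p M Y lam = fps_inv (prob_deg_exp M Y lam - 1)"

text \<open>
  A determination of \<open>s \<mapsto> c\<^sup>s\<close> on the complex plane: each \<open>P s\<close> is one of the values
  \<open>exp (s * log c)\<close>, and the exponent law holds. Every map \<open>s \<mapsto> exp (s * L)\<close> with
  \<open>exp L = c\<close> qualifies, in particular the principal branch.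
\<close>

definition power_determination :: "complex \<Rightarrow> (complex \<Rightarrow> complex) \<Rightarrow> bool" where
  "power_determination c P \<longleftrightarrow>
     (\<forall>s. \<exists>L. exp L = c \<and> P s = exp (s * L)) \<and> (\<forall>s s'. P (s + s') = P s * P s')"

text \<open>
  The power \<open>F\<^sup>s = c\<^sup>s (1 + u)\<^sup>s\<close> of a series \<open>F = c (1 + u)\<close> with \<open>c = F(0) \<noteq> 0\<close>, where
  \<open>P\<close> is the determination used for \<open>c\<^sup>s\<close>.
\<close>

definition fps_cpow :: "(complex \<Rightarrow> complex) \<Rightarrow> complex fps \<Rightarrow> complex \<Rightarrow> complex fps" where
  "fps_cpow P F s =
     fps_const (P s) * (fps_binomial s oo (fps_const (inverse (fps_nth F 0)) * F - 1))"

text \<open>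
  In both families below \<open>P\<close> is a determination of the powers of \<open>E[Y]\<close>. The constant term is
  \<open>1 / E[Y]\<close> in the Bernoulli case, with \<open>(1 / E[Y])\<^sup>s = E[Y]\<close> to the power \<open>-s\<close>, and
  \<open>E[Y]\<close> in the Cauchy case.
\<close>

definition prob_deg_bernoulli ::
  "'a measure \<Rightarrow> ('a \<Rightarrow> real) \<Rightarrow> (complex \<Rightarrow> complex) \<Rightarrow> real \<Rightarrow> complex \<Rightarrow> nat \<Rightarrow> complex" where
  "prob_deg_bernoulli M Y P lam \<gamma> n =
     fact n * fps_nth (fps_cpow (\<lambda>s. P (- s)) (fps_X / (prob_deg_exp M Y lam - 1)) \<gamma>) n"

definition prob_deg_cauchy ::
  "'a measure \<Rightarrow> ('a \<Rightarrow> real) \<Rightarrow> (complex \<Rightarrow> complex) \<Rightarrow> real \<Rightarrow> complex \<Rightarrow> nat \<Rightarrow> complex" where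
  "prob_deg_cauchy M Y P lam \<gamma> n =
     fact n * fps_nth (fps_cpow P (fps_X / prob_deg_log1p M Y lam) \<gamma>) n"

end

theory Submission
  imports Defs
begin

unbundle no vec_syntax

text \<open>
  Write \<open>f = E[e\<^sub>\<lambda>\<^sup>Y(t)] - 1\<close>, \<open>\<phi> = t / f\<close> and let \<open>\<psi> = t / g\<close> for the compositional inverse \<open>g\<close>
  of \<open>f\<close>. Substituting \<open>f\<close> for \<open>t\<close> in \<open>g \<psi> = t\<close> shows that \<open>\<psi> \<circ> f = 1 / \<phi>\<close>, so
  \<open>\<psi>\<^sup>\<gamma> \<circ> f = \<phi>\<^sup>-\<^sup>\<gamma>\<close>. Lagrange inversion gives
  \<open>n [t\<^sup>n] \<psi>\<^sup>\<gamma> = [t\<^sup>n\<^sup>-\<^sup>1] (\<phi>\<^sup>-\<^sup>\<gamma>)' \<phi>\<^sup>n\<close>, and \<open>(\<phi>\<^sup>-\<^sup>\<gamma>)' \<phi>\<^sup>n = \<gamma> / (\<gamma> - n) (\<phi>\<^sup>n\<^sup>-\<^sup>\<gamma>)'\<close>.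
\<close>

section \<open>Lagrange inversion by coefficient extraction\<close>

lemma fps_compose_mult_nth_eq_sum:
  fixes f a G :: "'a::comm_ring_1 fps"
  assumes f0: "f $ 0 = 0"
  shows "((a oo f) * G) $ n = (\<Sum>m=0..n. a $ m * (f ^ m * G) $ n)"
proof -
  \<comment> \<open>The range of \<open>m\<close> is widened from \<open>k\<close> to
    \<open>n\<close>, so that the two sums below can be swapped; the added terms vanish since
    \<open>f ^ m\<close> starts at degree m or later.\<close>
  have ext: "(a oo f) $ k = (\<Sum>m=0..n. a $ m * (f ^ m) $ k)" if "k \<le> n" for k
    unfolding fps_compose_nth using that startsby_zero_power_prefix[OF f0]
    by (intro sum.mono_neutral_left) auto
  have "((a oo f) * G) $ n = (\<Sum>k=0..n. \<Sum>m=0..n. a $ m * ((f ^ m) $ k * G $ (n - k)))"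
    by (simp add: fps_mult_nth ext sum_distrib_right mult.assoc)
  also have "\<dots> = (\<Sum>m=0..n. a $ m * (f ^ m * G) $ n)"
    by (subst sum.swap) (simp add: fps_mult_nth sum_distrib_left)
  finally show ?thesis .
qed

text \<open>This is the residue of \<open>f'\<close> times f to the power m - n - 1, because \<phi>
  = X / f: a derivative, hence residue 0, unless m = n, where the logarithmic derivative of a series
  of order 1 has residue 1. Trading m factors f \<phi> for X keeps the argument inside power
  series.\<close>

lemma fps_power_deriv_power_nth:
  fixes f \<phi> :: "'a::field_char_0 fps"
  assumes f\<phi>: "f * \<phi> = fps_X" and f0: "f $ 0 = 0" and mn: "m \<le> n"
  shows "(f ^ m * (fps_deriv f * \<phi> ^ Suc n)) $ n = (if m = n then 1 else 0)"
proof -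
  have d: "fps_deriv f * \<phi> = 1 - f * fps_deriv \<phi>"
    using arg_cong[OF f\<phi>, of fps_deriv] by (simp add: algebra_simps)
  obtain j where n: "n = m + j" using mn le_Suc_ex by blast
  have "f ^ m * (fps_deriv f * \<phi> ^ Suc n) = (f * \<phi>) ^ m * (fps_deriv f * \<phi> * \<phi> ^ j)"
    by (simp add: n power_add power_mult_distrib mult_ac)
  hence "(f ^ m * (fps_deriv f * \<phi> ^ Suc n)) $ n = ((1 - f * fps_deriv \<phi>) * \<phi> ^ j) $ j"
    by (simp add: f\<phi> n d fps_X_power_mult_nth)
  also have "\<dots> = (if j = 0 then 1 else 0)"
  proof (cases j)
    case 0
    thus ?thesis by (simp add: f0)
  next
    case (Suc i)
    have "(1 - f * fps_deriv \<phi>) * \<phi> ^ j = \<phi> ^ Suc i - fps_X * (fps_deriv \<phi> * \<phi> ^ i)"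
      by (simp add: Suc f\<phi>[symmetric] algebra_simps)
    \<comment> \<open>Multiplying by j = \<open>Suc i\<close> turns the last term into X times the
      derivative of \<open>\<phi> ^ j\<close>. Its coefficient at j is j times that of
      \<open>\<phi> ^ j\<close>, so the difference vanishes there.\<close>
    hence "of_nat (Suc i) * ((1 - f * fps_deriv \<phi>) * \<phi> ^ j)
        = of_nat (Suc i) * \<phi> ^ Suc i - fps_X * (of_nat (Suc i) * fps_deriv \<phi> * \<phi> ^ i)"
      by (simp only: right_diff_distrib mult_ac)
    also have "\<dots> = fps_const (of_nat (Suc i)) * \<phi> ^ Suc i - fps_X * fps_deriv (\<phi> ^ Suc i)"
      by (simp only: fps_deriv_power' fps_of_nat diff_Suc_1)
    finally have "(of_nat (Suc i) * ((1 - f * fps_deriv \<phi>) * \<phi> ^ j)) $ j = 0"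
      by (simp only: Suc) (simp del: power_Suc of_nat_Suc)
    hence "of_nat (Suc i) * ((1 - f * fps_deriv \<phi>) * \<phi> ^ j) $ j = 0"
      by (simp only: fps_of_nat[symmetric] fps_mult_left_const_nth)
    thus ?thesis using Suc by (simp del: of_nat_Suc)
  qed
  finally show ?thesis by (simp add: n)
qed

text \<open>By the chain rule the derivative of \<open>K oo f\<close> is a combination of the terms
  \<open>f ^ m * fps_deriv f\<close> with the coefficients of K'; the preceding orthogonality
  selects the one with m = n.\<close>

theorem fps_lagrange_inversion:
  fixes f \<phi> K :: "'a::field_char_0 fps"
  assumes "f * \<phi> = fps_X" and f0: "f $ 0 = 0"
  shows "(fps_deriv (K oo f) * \<phi> ^ Suc n) $ n = of_nat (Suc n) * K $ Suc n"
proof -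
  have "(fps_deriv (K oo f) * \<phi> ^ Suc n) $ n
      = (\<Sum>m=0..n. fps_deriv K $ m * (f ^ m * (fps_deriv f * \<phi> ^ Suc n)) $ n)"
    by (simp only: fps_compose_deriv[OF f0] mult.assoc fps_compose_mult_nth_eq_sum[OF f0])
  also have "\<dots> = (\<Sum>m=0..n. fps_deriv K $ m * (if m = n then 1 else 0))"
    by (intro sum.cong refl) (simp only: fps_power_deriv_power_nth[OF assms] atLeastAtMost_iff)
  also have "\<dots> = of_nat (Suc n) * K $ Suc n"
    by (simp add: mult_delta_right)
  finally show ?thesis .
qed

section \<open>Powers with arbitrary exponent, and Lagrange inversion for them\<close>

lemma fps_deriv_binomial:
  "fps_deriv (fps_binomial s) = fps_const s * fps_binomial (s - 1 :: 'a::field_char_0)"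
  using fps_binomial_add_mult[of s "-1"]
  by (simp add: fps_binomial_deriv fps_divide_unit fps_binomial_minus_one mult.assoc)

text \<open>For general s both sides are identified as the solution of (1 + X) y' = - s y with
  constant term 1.\<close>

lemma fps_binomial_compose_inverse:
  "fps_binomial s oo (inverse (1 + fps_X) - 1) = fps_binomial (- s :: 'a::field_char_0)"
proof -
  define w :: "'a fps" where "w = inverse (1 + fps_X) - 1"
  define z where "z = (fps_binomial (s - 1) oo w)"
  have w0: "w $ 0 = 0" by (simp add: w_def)
  have w: "w = fps_binomial (-1) - 1" by (simp add: w_def fps_binomial_minus_one)
  have dw: "fps_deriv w = - (fps_binomial (-1) * fps_binomial (-1))"
    by (simp add: w fps_deriv_binomial fps_binomial_add_mult[symmetric] del: fps_const_neg
        flip: fps_const_neg)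
  \<comment> \<open>One factor 1 + w = 1 / (1 + X) is split off, leaving z; the other factor 1 / (1
    + X) of w' then becomes the denominator of the differential equation.\<close>
  have "fps_binomial s = fps_binomial (s - 1) * (1 + fps_X)"
    using fps_binomial_add_mult[of "s - 1" 1] by (simp add: fps_binomial_1)
  hence y: "fps_binomial s oo w = z * fps_binomial (-1)"
    by (simp add: fps_compose_mult_distrib[OF w0] fps_compose_add_distrib w0 z_def)
       (simp add: w)
  have "fps_deriv (fps_binomial s oo w) = fps_const s * z * fps_deriv w"
    by (simp add: fps_compose_deriv[OF w0] fps_deriv_binomial fps_compose_mult_distrib[OF w0] z_def)
  also have "\<dots> = fps_const (- s) * (fps_binomial s oo w) / (1 + fps_X)"
    by (simp add: dw y fps_divide_unit fps_binomial_minus_one mult_ac flip: fps_const_neg)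
  finally have "fps_binomial s oo w = fps_binomial (- s)"
    by (intro iffD1[OF fps_binomial_ODE_unique'] conjI) simp_all
  thus ?thesis by (simp add: w_def)
qed

text \<open>Only meaningful when \<open>u\<close> has constant term \<open>1\<close>, since \<^const>\<open>fps_compose\<close> does not check convergence.\<close>

definition fps_binpow :: "'a::field_char_0 fps \<Rightarrow> 'a \<Rightarrow> 'a fps" where
  "fps_binpow u s = fps_binomial s oo (u - 1)"

lemma fps_binpow_nth_0 [simp]: "fps_binpow u s $ 0 = 1"
  by (simp add: fps_binpow_def)

lemma fps_binpow_add:
  "u $ 0 = 1 \<Longrightarrow> fps_binpow u (s + t) = fps_binpow u s * fps_binpow u t"
  by (simp add: fps_binpow_def fps_binomial_add_mult fps_compose_mult_distrib)

lemma fps_binpow_of_nat: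
  assumes "u $ 0 = 1"
  shows "fps_binpow u (of_nat n) = u ^ n"
  using assms
  by (simp add: fps_binpow_def fps_binomial_of_nat fps_compose_add_distrib
      flip: fps_compose_power)

lemma fps_deriv_binpow:
  "u $ 0 = 1 \<Longrightarrow> fps_deriv (fps_binpow u s) = fps_const s * fps_binpow u (s - 1) * fps_deriv u"
  by (simp add: fps_binpow_def fps_compose_deriv fps_deriv_binomial fps_compose_mult_distrib)

lemma fps_binpow_compose:
  "u $ 0 = 1 \<Longrightarrow> f $ 0 = 0 \<Longrightarrow> fps_binpow u s oo f = fps_binpow (u oo f) s"
  by (simp add: fps_binpow_def fps_compose_assoc[symmetric] fps_compose_sub_distrib)

text \<open>Here v arises from 1 / (1 + X) by substituting u - 1 for X, which reduces the claim to
  the binomial series itself.\<close>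

lemma fps_binpow_inverse:
  assumes uv: "v * u = 1" and u0: "u $ 0 = 1"
  shows "fps_binpow v s = fps_binpow u (- s)"
proof -
  have w0: "(u - 1) $ 0 = 0" by (simp add: u0)
  have "(inverse (1 + fps_X) * (1 + fps_X)) oo (u - 1) = (1 :: 'a fps)"
    by (subst inverse_mult_eq_1) simp_all
  hence "(inverse (1 + fps_X) oo (u - 1)) * u = v * u"
    by (simp add: fps_compose_mult_distrib[OF w0] fps_compose_add_distrib u0 uv)
  moreover have "u \<noteq> 0" using u0 by auto
  ultimately have "v = inverse (1 + fps_X) oo (u - 1)"
    by simp
  hence "v - 1 = (inverse (1 + fps_X) - 1) oo (u - 1)"
    by (simp add: fps_compose_sub_distrib)
  hence "fps_binpow v s = fps_binomial s oo (inverse (1 + fps_X) - 1) oo (u - 1)"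
    unfolding fps_binpow_def using w0 by (simp only:) (subst fps_compose_assoc, simp_all)
  thus ?thesis by (simp add: fps_binomial_compose_inverse fps_binpow_def)
qed

text \<open>The bases are rescaled to constant term 1, as \<open>fps_binpow\<close> requires.
  Lagrange inversion involves the unscaled \<open>\<phi> ^ n\<close>, and \<open>c ^ n\<close>
  compensates for that.\<close>

lemma fps_lagrange_inversion_binpow:
  fixes f \<phi> \<psi> :: "'a::field_char_0 fps"
  assumes f\<phi>: "f * \<phi> = fps_X" and f0: "f $ 0 = 0"
    and \<psi>: "(\<psi> oo f) * \<phi> = 1"
    and c: "c * \<phi> $ 0 = 1" and \<gamma>: "\<gamma> \<noteq> of_nat n"
  shows "c ^ n * fps_binpow (fps_const (inverse c) * \<psi>) \<gamma> $ n
       = \<gamma> / (\<gamma> - of_nat n) * fps_binpow (fps_const c * \<phi>) (of_nat n - \<gamma>) $ n"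
proof (cases n)
  \<comment> \<open>Lagrange inversion determines only n times the coefficient, so n = 0 is
    separate; there both sides equal 1.\<close>
  case 0
  thus ?thesis using \<gamma> by simp
next
  case (Suc k)
  define a where "a = fps_const c * \<phi>"
  define b where "b = fps_const (inverse c) * \<psi>"
  have c0: "c \<noteq> 0" using c by auto
  have a0: "a $ 0 = 1" by (simp add: a_def c)
  have "\<psi> $ 0 * \<phi> $ 0 = 1" using arg_cong[OF \<psi>, of "\<lambda>x. x $ 0"] by simp
  hence "\<psi> $ 0 = c" using c by (metis mult.assoc mult.commute mult_1)
  hence b0: "b $ 0 = 1" using c0 by (simp add: b_def)
  have "(b oo f) * a = (fps_const (inverse c) * fps_const c) * ((\<psi> oo f) * \<phi>)"
    by (simp only: a_def b_def fps_compose_mult_distrib[OF f0] fps_const_compose mult_ac)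
  hence "(b oo f) * a = 1" using c0 \<psi> by simp
  hence K: "fps_binpow b \<gamma> oo f = fps_binpow a (- \<gamma>)"
    by (simp add: fps_binpow_compose[OF b0 f0] fps_binpow_inverse[OF _ a0])
  have s: "- \<gamma> - 1 + of_nat n = of_nat n - \<gamma> - 1" by simp
  have "fps_const (c ^ n) * (fps_deriv (fps_binpow b \<gamma> oo f) * \<phi> ^ n)
      = fps_deriv (fps_binpow a (- \<gamma>)) * fps_binpow a (of_nat n)"
    unfolding K fps_binpow_of_nat[OF a0] by (simp add: a_def power_mult_distrib mult_ac)
  also have "\<dots> = fps_const (- \<gamma>) * (fps_binpow a (of_nat n - \<gamma> - 1) * fps_deriv a)"
    unfolding fps_deriv_binpow[OF a0] s[symmetric] fps_binpow_add[OF a0] by (simp only: mult_ac)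
  finally have "fps_const (of_nat n - \<gamma>) * (fps_const (c ^ n) *
        (fps_deriv (fps_binpow b \<gamma> oo f) * \<phi> ^ n))
      = fps_const (- \<gamma>) * fps_deriv (fps_binpow a (of_nat n - \<gamma>))"
    unfolding fps_deriv_binpow[OF a0] by (simp only: mult_ac)
  \<comment> \<open>At degree k = n - 1 both derivatives contribute a factor n, which is nonzero and
    cancels.\<close>
  hence "(fps_const (of_nat n - \<gamma>) * (fps_const (c ^ n) *
        (fps_deriv (fps_binpow b \<gamma> oo f) * \<phi> ^ n))) $ k
      = (fps_const (- \<gamma>) * fps_deriv (fps_binpow a (of_nat n - \<gamma>))) $ k"
    by (rule arg_cong)
  hence "(of_nat n - \<gamma>) * (c ^ n * (of_nat n * fps_binpow b \<gamma> $ n))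
      = - \<gamma> * (of_nat n * fps_binpow a (of_nat n - \<gamma>) $ n)"
    unfolding fps_mult_left_const_nth fps_deriv_nth
    by (simp only: Suc fps_lagrange_inversion[OF f\<phi> f0] Suc_eq_plus1[symmetric])
  hence "of_nat n * ((\<gamma> - of_nat n) * (c ^ n * fps_binpow b \<gamma> $ n))
      = of_nat n * (\<gamma> * fps_binpow a (of_nat n - \<gamma>) $ n)"
    by (simp add: algebra_simps)
  hence "(\<gamma> - of_nat n) * (c ^ n * fps_binpow b \<gamma> $ n) = \<gamma> * fps_binpow a (of_nat n - \<gamma>) $ n"
    by (simp only: mult_cancel_left) (simp add: Suc del: of_nat_Suc)
  thus ?thesis using \<gamma> by (simp add: a_def b_def field_simps)
qed

section \<open>Quotients of X by delta series\<close>

lemma fps_X_div_delta: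
  fixes f :: "'a::field fps"
  assumes "f $ 0 = 0" and "f $ 1 \<noteq> 0"
  shows "f * (fps_X / f) = fps_X" and "(fps_X / f) $ 0 = inverse (f $ 1)"
proof -
  \<comment> \<open>Order exactly 1 makes f divide X, so that \<open>fps_X / f\<close> is a true
    quotient.\<close>
  have sd: "subdegree f = 1" using assms by (intro subdegreeI) auto
  have "f \<noteq> 0" using assms by auto
  hence "f dvd fps_X" by (simp add: fps_dvd_iff sd)
  thus *: "f * (fps_X / f) = fps_X" by simp
  have "(f * (fps_X / f)) $ 1 = 1" by (subst *) simp
  hence "f $ 1 * (fps_X / f) $ 0 = 1" by (simp add: fps_mult_nth assms)
  thus "(fps_X / f) $ 0 = inverse (f $ 1)"
    by (simp add: inverse_unique)
qed

lemma fps_X_div_fps_inv_compose: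
  fixes f :: "'a::field fps"
  assumes f0: "f $ 0 = 0" and f1: "f $ 1 \<noteq> 0"
  shows "((fps_X / fps_inv f) oo f) * (fps_X / f) = 1"
proof -
  have g: "fps_inv f $ 0 = 0" "fps_inv f $ 1 \<noteq> 0"
    using f1 by (simp_all add: fps_inv_def)
  have "(fps_inv f * (fps_X / fps_inv f)) oo f = f"
    by (simp add: fps_X_div_delta(1)[OF g] f0)
  hence "fps_X * ((fps_X / fps_inv f) oo f) = f"
    by (simp add: fps_compose_mult_distrib[OF f0] fps_inv[OF f0 f1])
  hence "fps_X * (((fps_X / fps_inv f) oo f) * (fps_X / f)) = fps_X * 1"
    by (simp add: mult.assoc[symmetric] fps_X_div_delta(1)[OF f0 f1])
  thus ?thesis by (subst (asm) mult_cancel_left) simp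
qed

section \<open>Determinations of powers and the probabilistic numbers\<close>

lemma power_determination_of_nat:
  assumes "power_determination c P"
  shows "P (s + of_nat n) = P s * c ^ n"
proof (induction n)
  case 0
  show ?case by simp
next
  case (Suc n)
  \<comment> \<open>The logarithm L may vary with s, but at s = 1 every choice gives exp L =
    c.\<close>
  have "P 1 = c"
    using assms unfolding power_determination_def by (metis mult_1)
  moreover have "P (s + of_nat n + 1) = P (s + of_nat n) * P 1"
    using assms unfolding power_determination_def by blast
  ultimately show ?case using Suc by (simp add: add_ac mult_ac)
qed

lemma prob_deg_exp_nth_0: "prob_space M \<Longrightarrow> prob_deg_exp M Y lam $ 0 = 1"
  by (simp add: prob_deg_exp_def deg_ffact_def prob_space.prob_space)

lemma prob_deg_exp_nth_1: "prob_deg_exp M Y lam $ 1 = complex_of_real (integral\<^sup>L M Y)"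
  by (simp add: prob_deg_exp_def deg_ffact_def)

theorem theorem4p5:
  fixes M :: "'a measure" and Y :: "'a \<Rightarrow> real" and P :: "complex \<Rightarrow> complex"
    and lam :: real and \<gamma> :: complex and n :: nat
  assumes "prob_space M"
    and "Y \<in> borel_measurable M"
    and "has_mgf_near_0 M Y"
    and "integral\<^sup>L M Y \<noteq> 0"
    and "power_determination (complex_of_real (integral\<^sup>L M Y)) P"
    and "lam \<noteq> 0"
    and "\<gamma> \<noteq> of_nat n"
  shows "prob_deg_cauchy M Y P lam \<gamma> n
           = \<gamma> / (\<gamma> - of_nat n) * prob_deg_bernoulli M Y P lam (of_nat n - \<gamma>) n"
proof -
  define c where "c = complex_of_real (integral\<^sup>L M Y)"
  define f where "f = prob_deg_exp M Y lam - 1"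
  define \<phi> where "\<phi> = fps_X / f"
  define \<psi> where "\<psi> = fps_X / fps_inv f"
  have c0: "c \<noteq> 0" using assms(4) by (simp add: c_def)
  have f0: "f $ 0 = 0" by (simp add: f_def prob_deg_exp_nth_0[OF assms(1)])
  have f1: "f $ 1 = c" using prob_deg_exp_nth_1[of M Y lam] by (simp add: f_def c_def)
  have f1': "f $ 1 \<noteq> 0" using f1 c0 by simp
  have f\<phi>: "f * \<phi> = fps_X" and \<phi>0: "\<phi> $ 0 = inverse c"
    using fps_X_div_delta[OF f0 f1'] by (simp_all only: \<phi>_def f1)
  have \<psi>\<phi>: "(\<psi> oo f) * \<phi> = 1"
    unfolding \<psi>_def \<phi>_def by (rule fps_X_div_fps_inv_compose[OF f0 f1'])
  have \<psi>0: "\<psi> $ 0 = c"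
    using arg_cong[OF \<psi>\<phi>, of "\<lambda>x. x $ 0"] c0 by (simp add: \<phi>0 field_simps)
  \<comment> \<open>The Bernoulli power of order n - \<gamma> carries the constant P (\<gamma> - n);
    the remaining \<open>c ^ n\<close> is the factor in the Lagrange formula.\<close>
  have P: "P \<gamma> = P (\<gamma> - of_nat n) * c ^ n"
    using power_determination_of_nat[OF assms(5), of "\<gamma> - of_nat n" n] by (simp add: c_def)
  have "prob_deg_cauchy M Y P lam \<gamma> n
      = fact n * P (\<gamma> - of_nat n) * (c ^ n * fps_binpow (fps_const (inverse c) * \<psi>) \<gamma> $ n)"
    unfolding prob_deg_cauchy_def prob_deg_log1p_def f_def[symmetric] \<psi>_def[symmetric]
      fps_cpow_def \<psi>0 fps_binpow_def[symmetric] fps_mult_left_const_nth P by (simp only: mult_ac)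
  also have "\<dots> = fact n * P (\<gamma> - of_nat n) *
      (\<gamma> / (\<gamma> - of_nat n) * fps_binpow (fps_const c * \<phi>) (of_nat n - \<gamma>) $ n)"
    using fps_lagrange_inversion_binpow[OF f\<phi> f0 \<psi>\<phi> _ assms(7), of c] c0
    by (simp only: \<phi>0) simp
  also have "\<dots> = \<gamma> / (\<gamma> - of_nat n) * prob_deg_bernoulli M Y P lam (of_nat n - \<gamma>) n"
    unfolding prob_deg_bernoulli_def f_def[symmetric] \<phi>_def[symmetric]
      fps_cpow_def \<phi>0 fps_binpow_def[symmetric] fps_mult_left_const_nth inverse_inverse_eq
      minus_diff_eq by (simp only: mult_ac)
  finally show ?thesis .
qed

end
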